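(* Let $A$ be a set of positive integers such that, if one denotes by $q$ the greatest common divisor of $A$ and by $u_n$ the quotient $|\mathfrak{S}_{qn}^{(A)}|/(qn)!$, one has $$\frac{u_n}{u_{n-1}}\longrightarrow 1\quad\text{as } n\to\infty.$$ For $n$ large enough, let $\sigma_n$ be a random permutation which has the uniform distribution on $\mathfrak{S}_{qn}^{(A)}$. Then for all $l\geq 1$, the distribution of the random vector $$(N_k(\sigma_n))_{1\leq k\leq l,\ k\in A}$$ converges weakly, as $n$ goes to infinity, to $$\bigotimes_{1\leq k\leq l,\ k\in A}\operatorname{Poiss}(1/k).$$
   Context: For $A$ a set of positive integers, $\mathfrak{S}_n^{(A)}$ is the set of permutations of $\{1,\ldots,n\}$ all of whose cycles have length in $A$ (fixed points count as cycles of length $1$); $|I|$ denotes the cardinality of a set $I$. For $n$ large enough, $\mathfrak{S}_n^{(A)}$ is nonempty if and only if $n$ is divisible by the greatest common divisor of $A$. For a permutation $\sigma$ and $k$ a positive integer, $N_k(\sigma)$ is the number of cycles of length $k$ in the decomposition of $\sigma$ as a product of cycles with disjoint supports. For $\lambda>0$, $\operatorname{Poiss}(\lambda)$ is the Poisson distribution with mean $\lambda$. *)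

theory Defs
  imports "HOL-Probability.Probability" "HOL-Combinatorics.Orbits"
begin

(* A cycle of a permutation p of {1..n} is represented by its support, which is an orbit of p;
   its length is the cardinality of that orbit, and fixed points are orbits of size 1.
   The cycle itself is recovered as perm_restrict p (orbit p x). *)
definition perm_cycles :: "(nat \<Rightarrow> nat) \<Rightarrow> nat \<Rightarrow> nat set set" where
  "perm_cycles p n = orbit p ` {1..n}"

definition perms_with_cycle_lengths :: "nat set \<Rightarrow> nat \<Rightarrow> (nat \<Rightarrow> nat) set" where
  "perms_with_cycle_lengths A n = {p. p permutes {1..n} \<and> (\<forall>c\<in>perm_cycles p n. card c \<in> A)}"

definition cycle_count :: "nat \<Rightarrow> nat \<Rightarrow> (nat \<Rightarrow> nat) \<Rightarrow> nat" where
  "cycle_count n k p = card {c \<in> perm_cycles p n. card c = k}"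

(* The library's weak_conv_m only covers measures on the real line.  The measures are meant to be
   finite measures for which all continuous real functions on X are measurable. *)
definition weak_conv_in :: "'a topology \<Rightarrow> (nat \<Rightarrow> 'a measure) \<Rightarrow> 'a measure \<Rightarrow> bool" where
  "weak_conv_in X \<mu> \<nu> \<longleftrightarrow>
     (\<forall>f. continuous_map X euclideanreal f \<and> bounded (f ` topspace X) \<longrightarrow>
          (\<lambda>n. integral\<^sup>L (\<mu> n) f) \<longlonglongrightarrow> integral\<^sup>L \<nu> f)"

end

theory Submission
  imports Defs "HOL-Combinatorics.Cycles"
begin

text \<open>
  Cutting out a marked k-cycle turns a permutation of n points into one of n - k points, so the
  binomial moments of the number of k-cycles, jointly with the other cycle counts, reduce to sums
  over permutations of n - mk points. By inclusion-exclusion, the normalized number of permutations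
  with prescribed counts for k and for a finite set K of other lengths is an alternating exponential
  series in the corresponding quantities for K alone. Divided by u n, each term of that series
  converges because u (n - s) / u n tends to 1 for fixed s, and Tannery's theorem
  applies because u (n - s) / u n is at most C * 2 ^ s. Adding the lengths one at a time
  gives convergence of all point probabilities to products of Poisson weights. On a countable
  discrete space this implies weak convergence, by Scheffe's lemma.
\<close>

section \<open>Marking a cycle\<close>

text \<open>The ground set is arbitrary because deleting a cycle from a permutation of
  \<open>{1..n}\<close> leaves a set that need not be an initial segment.\<close>

definition restricted_perms :: "nat set \<Rightarrow> 'a set \<Rightarrow> ('a \<Rightarrow> 'a) set" where
  "restricted_perms A S = {p. p permutes S \<and> (\<forall>x\<in>S. card (orbit p x) \<in> A)}"

definition cycle_type :: "('a \<Rightarrow> 'a) \<Rightarrow> 'a set \<Rightarrow> nat \<Rightarrow> nat" where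
  "cycle_type p S k = card {c \<in> orbit p ` S. card c = k}"

lemma finite_restricted_perms [simp]: "finite S \<Longrightarrow> finite (restricted_perms A S)"
  by (rule finite_subset[OF _ finite_permutations]) (auto simp: restricted_perms_def)

lemma self_in_orbit_permutes:
  "p permutes S \<Longrightarrow> finite S \<Longrightarrow> x \<in> orbit p x"
  by (rule permutation_self_in_orbit) (auto simp: permutation_permutes)

lemma orbit_eq_permutes:
  "p permutes S \<Longrightarrow> finite S \<Longrightarrow> y \<in> orbit p x \<Longrightarrow> orbit p y = orbit p x"
  by (rule orbit_cyclic_eq3[OF cyclic_on_orbit])

section \<open>Relabelling the ground set\<close>

lemma orbit_relabel:
  assumes "finite S" "bij_betw f S T" "p permutes S" "a \<in> S"
  defines "q \<equiv> (\<lambda>x. if x \<in> T then f (p (inv_into S f x)) else x)"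
  shows "orbit q (f a) = f ` orbit p a"
proof (rule orbit_inverse[symmetric])
  show "a \<in> orbit p a"
    using assms by (intro self_in_orbit_permutes)
  fix x assume "x \<in> orbit p a"
  hence "x \<in> S"
    using permutes_orbit_subset[OF assms(3,4)] by auto
  thus "q (f x) = f (p x)"
    using assms(2) by (auto simp: q_def bij_betw_def)
qed

text \<open>Conjugation by \<open>f\<close> is a bijection between the permutations of
  \<open>S\<close> and those of \<open>T\<close>. It sends each orbit to its image under
  \<open>f\<close>, so orbit sizes and their multiplicities survive. Hence such sums depend on the
  ground set only through its cardinality.\<close>

lemma sum_cycle_type_relabel:
  fixes F :: "(nat \<Rightarrow> nat) \<Rightarrow> real"
  assumes fin: "finite S" and bij: "bij_betw f S T"
  shows "(\<Sum>p\<in>restricted_perms A T. F (cycle_type p T)) =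
    (\<Sum>p\<in>restricted_perms A S. F (cycle_type p S))"
proof -
  define g where "g = (\<lambda>p x. if x \<in> T then f (p (inv_into S f x)) else x)"
  have T: "T = f ` S" and inj: "inj_on f S"
    using bij by (auto simp: bij_betw_def)
  have orb: "orbit (g p) ` T = image f ` orbit p ` S" if "p permutes S" for p
    unfolding T image_image
    using orbit_relabel[OF fin bij that] by (intro image_cong) (auto simp: g_def T)
  have card: "card (f ` c) = card c" if "p permutes S" "c \<in> orbit p ` S" for p c
    using that inj permutes_orbit_subset[OF that(1)]
    by (intro card_image inj_on_subset[OF inj]) auto
  have g: "bij_betw g {p. p permutes S} {p. p permutes T}"
    unfolding g_def by (rule bij_betw_permutations[OF bij])
  have restr: "(\<forall>x\<in>T. card (orbit (g p) x) \<in> A) \<longleftrightarrow> (\<forall>x\<in>S. card (orbit p x) \<in> A)"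
    if "p permutes S" for p
  proof -
    have "(\<forall>x\<in>T. card (orbit (g p) x) \<in> A) \<longleftrightarrow> (\<forall>c\<in>orbit (g p) ` T. card c \<in> A)"
      by auto
    also have "\<dots> \<longleftrightarrow> (\<forall>c\<in>orbit p ` S. card c \<in> A)"
      unfolding orb[OF that] using card[OF that] by auto
    finally show ?thesis by auto
  qed
  have type: "cycle_type (g p) T = cycle_type p S" if p: "p permutes S" for p
  proof
    fix k
    have "{c \<in> orbit (g p) ` T. card c = k} = image f ` {c \<in> orbit p ` S. card c = k}"
      unfolding orb[OF p] using card[OF p] by auto
    \<comment> \<open>Distinct orbits have distinct images, so no cycles are merged in the
      count.\<close>
    moreover have "inj_on (image f) {c \<in> orbit p ` S. card c = k}"
      by (rule inj_on_subset[OF inj_on_image_Pow[OF inj]])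
        (use permutes_orbit_subset[OF p] in auto)
    ultimately show "cycle_type (g p) T k = cycle_type p S k"
      unfolding cycle_type_def by (simp add: card_image)
  qed
  have "bij_betw g (restricted_perms A S) (restricted_perms A T)"
    unfolding restricted_perms_def bij_betw_def
  proof (intro conjI)
    show "inj_on g {p. p permutes S \<and> (\<forall>x\<in>S. card (orbit p x) \<in> A)}"
      using g by (auto simp: bij_betw_def intro: inj_on_subset)
    show "g ` {p. p permutes S \<and> (\<forall>x\<in>S. card (orbit p x) \<in> A)} =
        {p. p permutes T \<and> (\<forall>x\<in>T. card (orbit p x) \<in> A)}"
    proof (intro equalityI subsetI)
      fix p assume "p \<in> g ` {p. p permutes S \<and> (\<forall>x\<in>S. card (orbit p x) \<in> A)}"
      thus "p \<in> {p. p permutes T \<and> (\<forall>x\<in>T. card (orbit p x) \<in> A)}"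
        using g restr by (auto simp: bij_betw_def)
    next
      fix p assume p: "p \<in> {p. p permutes T \<and> (\<forall>x\<in>T. card (orbit p x) \<in> A)}"
      then obtain r where "r permutes S" "p = g r"
        using g by (auto simp: bij_betw_def)
      thus "p \<in> g ` {p. p permutes S \<and> (\<forall>x\<in>S. card (orbit p x) \<in> A)}"
        using p restr by auto
    qed
  qed
  from sum.reindex_bij_betw[OF this, of "\<lambda>p. F (cycle_type p T)"] show ?thesis
    using type by (auto simp: restricted_perms_def intro!: sum.cong)
qed

text \<open>Orbits of a permutation coincide or are disjoint, so the orbits of size \<open>k\<close>
  partition these points into blocks of \<open>k\<close>.\<close>

lemma card_points_on_cycles:
  assumes fin: "finite S" and p: "p permutes S"
  shows "card {x \<in> S. card (orbit p x) = k} = k * cycle_type p S k"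
proof -
  let ?C = "{c \<in> orbit p ` S. card c = k}"
  have "{x \<in> S. card (orbit p x) = k} = \<Union> ?C"
  proof (intro equalityI subsetI)
    fix x assume "x \<in> \<Union> ?C"
    then obtain y where y: "y \<in> S" "card (orbit p y) = k" "x \<in> orbit p y"
      by auto
    moreover have "orbit p x = orbit p y"
      using orbit_eq_permutes[OF p fin y(3)] .
    ultimately show "x \<in> {x \<in> S. card (orbit p x) = k}"
      using permutes_orbit_subset[OF p y(1)] by auto
  qed (use self_in_orbit_permutes[OF p fin] in auto)
  also have "card \<dots> = (\<Sum>c\<in>?C. card c)"
  proof (rule card_Union_disjoint)
    show "disjoint ?C"
    proof (rule disjointI)
      fix c d assume "c \<in> ?C" "d \<in> ?C" "c \<noteq> d"
      then obtain x y where "c = orbit p x" "d = orbit p y" "orbit p x \<noteq> orbit p y"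
        by auto
      thus "c \<inter> d = {}"
        using orbit_eq_permutes[OF p fin] by blast
    qed
    show "finite c" if "c \<in> ?C" for c
      using that finite_orbit[OF self_in_orbit_permutes[OF p fin]] by auto
  qed
  also have "\<dots> = k * cycle_type p S k"
    by (simp add: cycle_type_def)
  finally show ?thesis .
qed

section \<open>Cycles given by lists\<close>

lemma funpow_cycle_of_list:
  assumes "distinct xs" "i < length xs"
  shows "(cycle_of_list xs ^^ i) (hd xs) = xs ! i"
proof -
  have "(cycle_of_list xs ^^ i) (xs ! 0) = map (cycle_of_list xs ^^ i) xs ! 0"
    using assms(2) by (subst nth_map) auto
  \<comment> \<open>Applying the \<open>i\<close>-th power of the cycle to every entry rotates the
    list by \<open>i\<close> places.\<close>
  also have "\<dots> = rotate i xs ! 0"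
    by (simp only: cyclic_rotation[OF assms(1)])
  also have "\<dots> = xs ! i"
    using assms(2) by (subst nth_rotate) auto
  finally show ?thesis
    using assms(2) by (cases xs) auto
qed

lemma orbit_cycle_of_list:
  assumes "distinct xs" "x \<in> set xs"
  shows "orbit (cycle_of_list xs) x = set xs"
proof -
  have ne: "xs \<noteq> []" using assms by auto
  have "orbit (cycle_of_list xs) (hd xs) = {(cycle_of_list xs ^^ m) (hd xs) |m. m < length xs}"
    by (rule orbit_altdef_bounded) (use ne in \<open>auto simp: cycle_is_id_root[OF assms(1)]\<close>)
  also have "\<dots> = set xs"
    using funpow_cycle_of_list[OF assms(1)] by (auto simp: set_conv_nth) metis
  finally have "orbit (cycle_of_list xs) (hd xs) = set xs" .
  thus ?thesis
    using orbit_eq_permutes[OF cycle_permutes, where x = "hd xs" and y = x] assms by simp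
qed

text \<open>Translates \<open>support\<close> and \<open>least_power\<close> into orbits:
  \<open>support p x\<close> runs through the orbit of \<open>x\<close> once, in the order of
  iteration.\<close>

lemma support_orbit:
  assumes "finite S" "p permutes S"
  shows "set (support p x) = orbit p x" and "least_power p x = card (orbit p x)"
    and "distinct (support p x)"
proof -
  have perm: "permutation p"
    using assms by (auto simp: permutation_permutes)
  show set: "set (support p x) = orbit p x"
    unfolding support_set[OF perm] orbit_altdef_permutation[OF perm] by auto
  show d: "distinct (support p x)"
    by (rule cycle_of_permutation[OF perm])
  show "least_power p x = card (orbit p x)"
    using distinct_card[OF d] unfolding set by simp
qed

section \<open>Inserting a cycle into a permutation of the remaining points\<close>

context
  fixes S :: "'a set" and xs :: "'a list" and r p :: "'a \<Rightarrow> 'a"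
  assumes fin: "finite S" and xs: "distinct xs" "set xs \<subseteq> S" and r: "r permutes S - set xs"
  defines "p \<equiv> cycle_of_list xs \<circ> r"
begin

lemma cycle_comp_permutes: "p permutes S"
  unfolding p_def
  by (intro permutes_compose permutes_subset[OF r] permutes_subset[OF cycle_permutes]) (use xs in auto)

lemma cycle_comp_on_cycle: "x \<in> set xs \<Longrightarrow> p x = cycle_of_list xs x"
  using permutes_not_in[OF r] by (auto simp: p_def)

lemma cycle_comp_off_cycle: "x \<in> S - set xs \<Longrightarrow> p x = r x"
  using permutes_in_image[OF r, of x] by (auto simp: p_def id_outside_supp)

lemma orbit_cycle_comp_on:
  assumes "x \<in> set xs" shows "orbit p x = set xs"
proof -
  have "orbit p x = orbit (cycle_of_list xs) x"
  proof (rule orbit_cong)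
    show "x \<in> orbit (cycle_of_list xs) x"
      by (rule self_in_orbit_permutes[OF cycle_permutes]) simp
  qed (use orbit_cycle_of_list[OF xs(1) assms] cycle_comp_on_cycle in auto)
  thus ?thesis
    using orbit_cycle_of_list[OF xs(1) assms] by simp
qed

lemma orbit_cycle_comp_off:
  assumes "x \<in> S - set xs" shows "orbit p x = orbit r x"
proof (rule orbit_cong)
  show "x \<in> orbit r x"
    by (rule self_in_orbit_permutes[OF r]) (use fin in simp)
qed (use permutes_orbit_subset[OF r assms] cycle_comp_off_cycle in auto)

text \<open>The iterates of \<open>p\<close> from \<open>hd xs\<close> never leave
  \<open>set xs\<close>, where \<open>p\<close> agrees with the inserted cycle. The list, including
  its starting point, can thus be read off from \<open>p\<close> and \<open>hd xs\<close>.\<close>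

lemma support_cycle_comp:
  assumes "xs \<noteq> []" shows "support p (hd xs) = xs"
proof -
  have pow: "(p ^^ i) (hd xs) = (cycle_of_list xs ^^ i) (hd xs)" for i
  proof (induction i)
    case (Suc i)
    have "(cycle_of_list xs ^^ i) (hd xs) \<in> set xs"
      using permutes_in_image[OF permutes_funpow[OF cycle_permutes[of xs]], of i "hd xs"] assms by simp
    thus ?case
      using Suc by (simp add: cycle_comp_on_cycle)
  qed simp
  have len: "least_power p (hd xs) = length xs"
    using support_orbit(2)[OF fin cycle_comp_permutes, of "hd xs"] orbit_cycle_comp_on[of "hd xs"]
      assms distinct_card[OF xs(1)] by simp
  show ?thesis
    unfolding len by (rule nth_equalityI) (auto simp: pow funpow_cycle_of_list[OF xs(1)])
qed

lemma perm_restrict_cycle_comp: "perm_restrict p (S - set xs) = r"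
  using permutes_not_in[OF r] cycle_comp_off_cycle by (auto simp: perm_restrict_def fun_eq_iff)

text \<open>The orbits of \<open>p\<close> are those of \<open>r\<close> together with
  \<open>set xs\<close>. The latter is new, since each orbit of \<open>r\<close> counted here
  contains a point outside \<open>set xs\<close>.\<close>

lemma cycle_type_cycle_comp:
  assumes "xs \<noteq> []"
  shows "cycle_type p S = (cycle_type r (S - set xs))(length xs := Suc (cycle_type r (S - set xs) (length xs)))"
proof
  fix k
  have "orbit p ` S = orbit p ` set xs \<union> orbit p ` (S - set xs)"
    using xs(2) by auto
  also have "orbit p ` set xs = {set xs}"
    using orbit_cycle_comp_on assms by (simp add: image_constant_conv cong: image_cong)
  also have "orbit p ` (S - set xs) = orbit r ` (S - set xs)"
    using orbit_cycle_comp_off by auto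
  finally have orb: "orbit p ` S = insert (set xs) (orbit r ` (S - set xs))"
    by simp
  have "set xs \<notin> orbit r ` (S - set xs)"
  proof
    assume "set xs \<in> orbit r ` (S - set xs)"
    then obtain y where "y \<in> S - set xs" "set xs = orbit r y"
      by auto
    thus False
      using self_in_orbit_permutes[OF r, of y] fin by auto
  qed
  moreover have "{c \<in> orbit p ` S. card c = k} =
    (if length xs = k then insert (set xs) {c \<in> orbit r ` (S - set xs). card c = k}
     else {c \<in> orbit r ` (S - set xs). card c = k})"
    using distinct_card[OF xs(1)] unfolding orb by auto
  ultimately show "cycle_type p S k =
    ((cycle_type r (S - set xs))(length xs := Suc (cycle_type r (S - set xs) (length xs)))) k"
    using fin by (auto simp: cycle_type_def)
qed

end

text \<open>Extraction followed by insertion gives back \<open>p\<close>: on the orbit of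
  \<open>x\<close> the cycle acts as \<open>p\<close>, and the complement of the orbit in
  \<open>S\<close> is invariant under \<open>p\<close>.\<close>

lemma perm_eq_cycle_comp:
  assumes fin: "finite S" and p: "p permutes S"
  shows "cycle_of_list (support p x) \<circ> perm_restrict p (S - set (support p x)) = p"
proof
  fix y
  have perm: "permutation p"
    using assms by (auto simp: permutation_permutes)
  consider "y \<in> set (support p x)" | "y \<in> S - set (support p x)" | "y \<notin> S" "y \<notin> set (support p x)"
    by blast
  thus "(cycle_of_list (support p x) \<circ> perm_restrict p (S - set (support p x))) y = p y"
  proof cases
    case 1
    thus ?thesis
      using cycle_restrict[OF perm 1] by (simp add: perm_restrict_def)
  next
    case 2
    have "p y \<notin> set (support p x)"
      using 2 unfolding support_orbit(1)[OF fin p]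
      using cyclic_on_f_in[OF p cyclic_on_orbit[OF p fin, of x]] by auto
    thus ?thesis
      using 2 by (simp add: perm_restrict_def id_outside_supp del: set_map)
  next
    case 3
    thus ?thesis
      using permutes_not_in[OF p] by (simp add: perm_restrict_def id_outside_supp del: set_map)
  qed
qed

text \<open>
  Double counting of the pairs (p, x) with x on a k-cycle of p: such a pair corresponds to the list
  of the k points of that cycle, started at x, together with the restriction of p to the other points.
\<close>
lemma sum_marked_cycle:
  fixes F :: "(nat \<Rightarrow> nat) \<Rightarrow> real"
  assumes fin: "finite S" and k: "k \<in> A" "0 < k"
  shows "(\<Sum>p\<in>restricted_perms A S. real (k * cycle_type p S k) * F (cycle_type p S)) =
    (\<Sum>xs\<in>{xs. length xs = k \<and> distinct xs \<and> set xs \<subseteq> S}. \<Sum>r\<in>restricted_perms A (S - set xs).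
       F ((cycle_type r (S - set xs))(k := Suc (cycle_type r (S - set xs) k))))"
proof -
  define X where "X = {xs. length xs = k \<and> distinct xs \<and> set xs \<subseteq> S}"
  have "finite X"
    unfolding X_def by (rule finite_subset[OF _ finite_lists_length_eq[OF fin, of k]]) auto
  let ?P = "SIGMA p:restricted_perms A S. {x \<in> S. card (orbit p x) = k}"
  let ?R = "SIGMA xs:X. restricted_perms A (S - set xs)"
  \<comment> \<open>Insertion: the new orbit has size \<open>k\<close>, an element of
    \<open>A\<close>, so the result is admissible, and \<open>xs\<close> and \<open>r\<close> can be
    recovered from it.\<close>
  have comp: "cycle_of_list xs \<circ> r \<in> restricted_perms A S \<and>
      hd xs \<in> {x \<in> S. card (orbit (cycle_of_list xs \<circ> r) x) = k} \<and>
      support (cycle_of_list xs \<circ> r) (hd xs) = xs \<and>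
      perm_restrict (cycle_of_list xs \<circ> r) (S - set xs) = r \<and>
      cycle_type (cycle_of_list xs \<circ> r) S =
        (cycle_type r (S - set xs))(k := Suc (cycle_type r (S - set xs) k))"
    if "xs \<in> X" "r \<in> restricted_perms A (S - set xs)" for xs r
  proof -
    have xs: "distinct xs" "set xs \<subseteq> S" "length xs = k" "xs \<noteq> []"
      and r: "r permutes S - set xs" and rA: "\<And>x. x \<in> S - set xs \<Longrightarrow> card (orbit r x) \<in> A"
      using that k by (auto simp: X_def restricted_perms_def)
    note [simp] = orbit_cycle_comp_on[OF fin xs(1,2) r] orbit_cycle_comp_off[OF fin xs(1,2) r]
    have card: "card (set xs) = k"
      using distinct_card[OF xs(1)] xs(3) by simp
    have "card (orbit (cycle_of_list xs \<circ> r) x) \<in> A" if "x \<in> S" for x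
      using that rA k card by (cases "x \<in> set xs") auto
    thus ?thesis
      using cycle_comp_permutes[OF fin xs(1,2) r] support_cycle_comp[OF fin xs(1,2) r xs(4)]
        perm_restrict_cycle_comp[OF fin xs(1,2) r] cycle_type_cycle_comp[OF fin xs(1,2) r xs(4)]
        xs hd_in_set[OF xs(4)] card
      by (auto simp: restricted_perms_def)
  qed
  \<comment> \<open>Extraction: the complement of the orbit of \<open>x\<close> is invariant, so
    restricting \<open>p\<close> to it leaves all other orbits unchanged and the result
    admissible.\<close>
  have decomp: "support p x \<in> X \<and>
      perm_restrict p (S - set (support p x)) \<in> restricted_perms A (S - set (support p x)) \<and>
      hd (support p x) = x"
    if "p \<in> restricted_perms A S" "x \<in> S" "card (orbit p x) = k" for p x
  proof (intro conjI)
    have p: "p permutes S" and pA: "\<And>x. x \<in> S \<Longrightarrow> card (orbit p x) \<in> A"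
      using that by (auto simp: restricted_perms_def)
    note supp = support_orbit[OF fin p]
    show "support p x \<in> X"
      unfolding X_def mem_Collect_eq
    proof (intro conjI)
      show "length (support p x) = k"
        using that(3) supp(2)[of x] by simp
      show "set (support p x) \<subseteq> S"
        unfolding supp(1) by (rule permutes_orbit_subset[OF p that(2)])
    qed (rule supp(3))
    have restr: "perm_restrict p (S - orbit p x) permutes (S - orbit p x)"
      by (rule perm_restrict_diff_cyclic[OF p cyclic_on_orbit[OF p fin]])
    have "orbit (perm_restrict p (S - orbit p x)) y = orbit p y" if y: "y \<in> S - orbit p x" for y
    proof (rule orbit_cong0[OF y, symmetric])
      show "p \<in> S - orbit p x \<rightarrow> S - orbit p x"
        using permutes_in_image[OF p] cyclic_on_f_in[OF p cyclic_on_orbit[OF p fin, of x]] by auto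
    qed (auto simp: perm_restrict_def)
    thus "perm_restrict p (S - set (support p x)) \<in> restricted_perms A (S - set (support p x))"
      unfolding supp(1) using restr pA by (auto simp: restricted_perms_def)
    have "permutation p"
      using p fin by (auto simp: permutation_permutes)
    thus "hd (support p x) = x"
      using least_power_of_permutation(2)[of p x] by (simp add: hd_map)
  qed
  \<comment> \<open>The weight \<open>k * cycle_type p S k\<close> is the number of points on
    \<open>k\<close>-cycles, that is, of choices for the marked point.\<close>
  have "(\<Sum>p\<in>restricted_perms A S. real (k * cycle_type p S k) * F (cycle_type p S)) =
      (\<Sum>p\<in>restricted_perms A S. \<Sum>x | x \<in> S \<and> card (orbit p x) = k. F (cycle_type p S))"
    using card_points_on_cycles[OF fin] by (intro sum.cong) (auto simp: restricted_perms_def)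
  also have "\<dots> = (\<Sum>(p, x)\<in>?P. F (cycle_type p S))"
    using fin by (intro sum.Sigma) auto
  also have "\<dots> = (\<Sum>(xs, r)\<in>?R. F ((cycle_type r (S - set xs))(k := Suc (cycle_type r (S - set xs) k))))"
  proof (rule sum.reindex_bij_witness[where
      i = "\<lambda>(xs, r). (cycle_of_list xs \<circ> r, hd xs)" and
      j = "\<lambda>(p, x). (support p x, perm_restrict p (S - set (support p x)))"], goal_cases)
    case (1 a)
    then obtain p x where a: "a = (p, x)" "p \<in> restricted_perms A S" "x \<in> S" "card (orbit p x) = k"
      by auto
    hence "p permutes S"
      by (auto simp: restricted_perms_def)
    thus ?case
      using decomp[OF a(2-4)] perm_eq_cycle_comp[OF fin, of p x] a(1) by (simp del: set_map)
  next
    case (2 a)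
    thus ?case
      using decomp by (auto simp del: set_map)
  next
    case (3 b)
    then obtain xs r where b: "b = (xs, r)" "xs \<in> X" "r \<in> restricted_perms A (S - set xs)"
      by auto
    thus ?case
      using comp[OF b(2,3)] by (simp del: set_map)
  next
    case (4 b)
    thus ?case
      using comp by auto
  next
    case (5 a)
    then obtain p x where a: "a = (p, x)" "p \<in> restricted_perms A S" "x \<in> S" "card (orbit p x) = k"
      by auto
    hence p: "p permutes S"
      by (auto simp: restricted_perms_def)
    show ?case
      using decomp[OF a(2-4)] comp[of "support p x" "perm_restrict p (S - set (support p x))"]
        perm_eq_cycle_comp[OF fin p, of x] a(1) by (simp del: set_map)
  qed
  also have "\<dots> = (\<Sum>xs\<in>X. \<Sum>r\<in>restricted_perms A (S - set xs).
       F ((cycle_type r (S - set xs))(k := Suc (cycle_type r (S - set xs) k))))"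
    using \<open>finite X\<close> fin by (intro sum.Sigma[symmetric]) auto
  finally show ?thesis
    unfolding X_def .
qed

text \<open>The normalization is by \<open>fact n\<close>, not by the number of admissible
  permutations: the number of lists of \<open>k\<close> distinct points, n!/(n - k)!, then cancels
  when a cycle is removed. For constant \<open>F = 1\<close> this is the sequence behind
  \<open>u\<close>.\<close>

definition cycle_sum :: "nat set \<Rightarrow> nat \<Rightarrow> ((nat \<Rightarrow> nat) \<Rightarrow> real) \<Rightarrow> real" where
  "cycle_sum A n F = (\<Sum>p\<in>restricted_perms A {1..n}. F (cycle_type p {1..n})) / fact n"

lemma cycle_sum_relabel:
  fixes S :: "nat set"
  assumes "finite S"
  shows "(\<Sum>p\<in>restricted_perms A S. F (cycle_type p S)) = fact (card S) * cycle_sum A (card S) F"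
proof -
  obtain f where "bij_betw f {1..card S} S"
    using assms by (metis card_atLeastAtMost diff_Suc_1 finite_atLeastAtMost finite_same_card_bij)
  from sum_cycle_type_relabel[OF _ this, of F A] show ?thesis
    by (simp add: cycle_sum_def)
qed

lemma cycle_sum_cmult: "cycle_sum A n (\<lambda>c. a * F c) = a * cycle_sum A n F"
  by (simp add: cycle_sum_def sum_distrib_left)

lemma cycle_sum_sum: "cycle_sum A n (\<lambda>c. \<Sum>j\<in>J. F j c) = (\<Sum>j\<in>J. cycle_sum A n (F j))"
  unfolding cycle_sum_def by (subst sum.swap) (simp add: sum_divide_distrib)

lemma cycle_type_le:
  assumes "finite S" "p permutes S" "0 < k"
  shows "cycle_type p S k \<le> card S"
proof -
  have "cycle_type p S k \<le> k * cycle_type p S k"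
    using assms(3) by simp
  also have "\<dots> = card {x \<in> S. card (orbit p x) = k}"
    using card_points_on_cycles[OF assms(1,2)] by simp
  also have "\<dots> \<le> card S"
    using assms(1) by (intro card_mono) auto
  finally show ?thesis .
qed

text \<open>Only count vectors bounded by \<open>n\<close> occur in the sum; this bound is what
  later allows alternating sums to be cut off at \<open>n\<close>.\<close>

lemma cycle_sum_cong:
  assumes "\<And>c. (\<And>k. 0 < k \<Longrightarrow> c k \<le> n) \<Longrightarrow> F c = G c"
  shows "cycle_sum A n F = cycle_sum A n G"
  unfolding cycle_sum_def
proof (intro arg_cong2[where f = "(/)"] sum.cong refl assms)
  fix p k assume "p \<in> restricted_perms A {1..n}" "0 < (k::nat)"
  thus "cycle_type p {1..n} k \<le> n"
    using cycle_type_le[of "{1..n}" p k] by (simp add: restricted_perms_def)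
qed

lemma abs_cycle_sum_le:
  assumes "\<And>c. \<bar>F c\<bar> \<le> 1"
  shows "\<bar>cycle_sum A n F\<bar> \<le> cycle_sum A n (\<lambda>_. 1)"
proof -
  have "\<bar>\<Sum>p\<in>restricted_perms A {1..n}. F (cycle_type p {1..n})\<bar> \<le> (\<Sum>p\<in>restricted_perms A {1..n}. 1)"
    by (intro sum_abs[THEN order_trans] sum_mono assms)
  thus ?thesis
    by (simp add: cycle_sum_def divide_right_mono)
qed

lemma cycle_sum_one_le: "cycle_sum A n (\<lambda>_. 1) \<le> 1"
proof -
  have "card (restricted_perms A {1..n}) \<le> card {p. p permutes {1..n}}"
    by (intro card_mono finite_permutations) (auto simp: restricted_perms_def)
  also have "\<dots> = fact n"
    by (simp add: card_permutations)
  finally have "real (card (restricted_perms A {1..n})) \<le> real (fact n)"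
    by (subst of_nat_le_iff)
  thus ?thesis
    by (simp add: cycle_sum_def)
qed

section \<open>Removing marked cycles: binomial moments and inclusion-exclusion\<close>

lemma card_distinct_lists:
  fixes S :: "'a set"
  assumes "finite S" "k \<le> card S"
  shows "card {xs. length xs = k \<and> distinct xs \<and> set xs \<subseteq> S} * fact (card S - k) = fact (card S)"
  unfolding card_lists_distinct_length_eq[OF assms] fact_prod of_nat_id id_def
  using assms(2) by (subst mult.commute, subst prod.union_disjoint[symmetric])
    (auto intro!: prod.cong)

text \<open>After relabelling, each list \<open>xs\<close> contributes the same sum over
  permutations of \<open>n - k\<close> points. The factor \<open>1 / k\<close> compensates for the
  \<open>k\<close> possible starting points of the marked cycle; for \<open>k > n\<close> there is
  no list to mark.\<close>

lemma cycle_sum_mark: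
  assumes k: "k \<in> A" "0 < k"
  shows "cycle_sum A n (\<lambda>c. real (c k) * F c) =
    (if k \<le> n then cycle_sum A (n - k) (\<lambda>c. F (c(k := Suc (c k)))) / k else 0)"
proof -
  define X where "X = {xs. length xs = k \<and> distinct xs \<and> set xs \<subseteq> {1..n}}"
  define G where "G = (\<lambda>c. F (c(k := Suc (c k))))"
  have "k * cycle_sum A n (\<lambda>c. real (c k) * F c) * fact n =
      (\<Sum>p\<in>restricted_perms A {1..n}. real (k * cycle_type p {1..n} k) * F (cycle_type p {1..n}))"
    unfolding cycle_sum_def of_nat_mult mult.assoc sum_distrib_left[symmetric] by simp
  also have "\<dots> = (\<Sum>xs\<in>X. \<Sum>r\<in>restricted_perms A ({1..n} - set xs). G (cycle_type r ({1..n} - set xs)))"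
    unfolding X_def G_def by (rule sum_marked_cycle) (use k in auto)
  also have "\<dots> = (\<Sum>xs\<in>X. fact (n - k) * cycle_sum A (n - k) G)"
  proof (rule sum.cong[OF refl])
    fix xs assume "xs \<in> X"
    hence "card ({1..n} - set xs) = n - k"
      using distinct_card[of xs] by (subst card_Diff_subset) (auto simp: X_def)
    thus "(\<Sum>r\<in>restricted_perms A ({1..n} - set xs). G (cycle_type r ({1..n} - set xs))) =
        fact (n - k) * cycle_sum A (n - k) G"
      by (subst cycle_sum_relabel) auto
  qed
  also have "\<dots> = real (card X * fact (n - k)) * cycle_sum A (n - k) G"
    by simp
  also have "\<dots> = (if k \<le> n then fact n * cycle_sum A (n - k) G else 0)"
  proof (cases "k \<le> n")
    case True
    hence "card X * fact (n - k) = fact n"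
      using card_distinct_lists[of "{1..n}" k] by (simp add: X_def)
    hence "real (card X * fact (n - k)) = fact n"
      by (simp only: of_nat_fact)
    thus ?thesis
      using True by (simp only: if_True)
  next
    case False
    have "X = {}"
    proof (rule ccontr)
      assume "X \<noteq> {}"
      then obtain xs where xs: "length xs = k" "distinct xs" "set xs \<subseteq> {1..n}"
        by (auto simp: X_def)
      thus False
        using card_mono[OF _ xs(3)] distinct_card[OF xs(2)] False by simp
    qed
    thus ?thesis
      using False by simp
  qed
  finally show ?thesis
    using k unfolding G_def by (simp add: field_simps split: if_splits)
qed

text \<open>Iterates \<open>cycle_sum_mark\<close>: each of the \<open>m\<close> removed cycles
  gives a factor \<open>1 / k\<close>, and the factorial accounts for the order of removal.\<close>

lemma cycle_sum_binomial:
  assumes k: "k \<in> A" "0 < k"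
  shows "cycle_sum A n (\<lambda>c. real (c k choose m) * F c) =
    (if m * k \<le> n then cycle_sum A (n - m * k) (\<lambda>c. F (c(k := c k + m))) / (real k ^ m * fact m) else 0)"
proof (induction m arbitrary: n F)
  case (Suc m)
  \<comment> \<open>Absorption,
    \<open>Suc m * (c k choose Suc m) = c k * ((c k - 1) choose m)\<close>, splits off one marked
    cycle. Removing it shifts the count by one, so \<open>c k - 1\<close> becomes the count of the
    remaining permutation.\<close>
  have "cycle_sum A n (\<lambda>c. real (c k choose Suc m) * F c) =
      cycle_sum A n (\<lambda>c. real (c k) * (1 / real (Suc m) * (real ((c k - 1) choose m) * F c)))"
  proof (rule cycle_sum_cong)
    fix c :: "nat \<Rightarrow> nat"
    have "Suc m * (c k choose Suc m) = c k * ((c k - 1) choose m)"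
      by (cases "c k") (simp_all only: Suc_times_binomial binomial_0_Suc diff_Suc_1 mult_0 mult_0_right)
    hence "real (Suc m) * real (c k choose Suc m) = real (c k) * real ((c k - 1) choose m)"
      by (metis of_nat_mult)
    hence "real (c k choose Suc m) = real (c k) * real ((c k - 1) choose m) / real (Suc m)"
      by (simp add: field_simps)
    thus "real (c k choose Suc m) * F c =
        real (c k) * (1 / real (Suc m) * (real ((c k - 1) choose m) * F c))"
      by simp
  qed
  also have "\<dots> = (if k \<le> n then
      cycle_sum A (n - k) (\<lambda>c. real (c k choose m) * F (c(k := Suc (c k)))) / (real k * real (Suc m)) else 0)"
    unfolding cycle_sum_mark[OF k] fun_upd_same diff_Suc_1 cycle_sum_cmult by (simp add: mult.commute)
  also have "\<dots> = (if Suc m * k \<le> n then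
      cycle_sum A (n - Suc m * k) (\<lambda>c. F (c(k := c k + Suc m))) / (real k ^ Suc m * fact (Suc m)) else 0)"
    by (subst Suc) (auto simp: algebra_simps)
  finally show ?case .
qed simp

text \<open>On \<open>c k = a\<close> the binomial weight equals 1 and can be inserted freely.
  Removing \<open>a\<close> cycles turns the condition into \<open>c k = 0\<close>, and
  \<open>F\<close> does not see the shift because it ignores coordinate \<open>k\<close>.\<close>

lemma cycle_sum_count_eq:
  assumes k: "k \<in> A" "0 < k" and F: "\<And>c v. F (c(k := v)) = F c"
  shows "cycle_sum A n (\<lambda>c. of_bool (c k = a) * F c) =
    (if a * k \<le> n then cycle_sum A (n - a * k) (\<lambda>c. of_bool (c k = 0) * F c) / (real k ^ a * fact a) else 0)"
proof -
  have "cycle_sum A n (\<lambda>c. of_bool (c k = a) * F c) =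
      cycle_sum A n (\<lambda>c. real (c k choose a) * (of_bool (c k = a) * F c))"
    by (rule cycle_sum_cong) auto
  also have "\<dots> = (if a * k \<le> n then
      cycle_sum A (n - a * k) (\<lambda>c. of_bool (c k = 0) * F c) / (real k ^ a * fact a) else 0)"
    by (subst cycle_sum_binomial[OF k]) (simp add: F)
  finally show ?thesis .
qed

text \<open>The binomial expansion of \<open>(1 - 1) ^ m\<close>; terms beyond \<open>m\<close>
  vanish, so one cutoff \<open>n\<close> serves all \<open>m\<close> up to \<open>n\<close>.\<close>

lemma of_bool_zero_alternating:
  assumes "m \<le> n"
  shows "(of_bool (m = 0) :: real) = (\<Sum>j\<le>n. (-1) ^ j * real (m choose j))"
proof -
  have "(\<Sum>j\<le>n. (-1) ^ j * real (m choose j)) = (\<Sum>j\<le>m. (-1) ^ j * real (m choose j))"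
    using assms by (intro sum.mono_neutral_right) auto
  also have "\<dots> = of_bool (m = 0)"
    using choose_alternating_sum[of m, where 'a = real] by (cases "m = 0") auto
  finally show ?thesis by simp
qed

text \<open>Inclusion-exclusion over sets of marked \<open>k\<close>-cycles. Only
  \<open>j * k \<le> n\<close> contributes, so the series is in fact finite; writing it as a series
  prepares for a limit taken term by term.\<close>

lemma cycle_sum_count_zero:
  assumes k: "k \<in> A" "0 < k" and F: "\<And>c v. F (c(k := v)) = F c"
  shows "cycle_sum A n (\<lambda>c. of_bool (c k = 0) * F c) =
    (\<Sum>j. if j * k \<le> n then (-1) ^ j / (real k ^ j * fact j) * cycle_sum A (n - j * k) F else 0)"
proof -
  have "cycle_sum A n (\<lambda>c. of_bool (c k = 0) * F c) =
      cycle_sum A n (\<lambda>c. \<Sum>j\<le>n. (-1) ^ j * (real (c k choose j) * F c))"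
  proof (rule cycle_sum_cong)
    fix c :: "nat \<Rightarrow> nat"
    assume "\<And>k. 0 < k \<Longrightarrow> c k \<le> n"
    hence "c k \<le> n"
      using k(2) .
    show "of_bool (c k = 0) * F c = (\<Sum>j\<le>n. (-1) ^ j * (real (c k choose j) * F c))"
      unfolding of_bool_zero_alternating[OF \<open>c k \<le> n\<close>] sum_distrib_right mult.assoc ..
  qed
  also have "\<dots> = (\<Sum>j\<le>n. if j * k \<le> n then (-1) ^ j / (real k ^ j * fact j) * cycle_sum A (n - j * k) F else 0)"
    unfolding cycle_sum_sum cycle_sum_cmult
    by (intro sum.cong) (auto simp: cycle_sum_binomial[OF k] F)
  also have "\<dots> = (\<Sum>j. if j * k \<le> n then (-1) ^ j / (real k ^ j * fact j) * cycle_sum A (n - j * k) F else 0)"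
  proof (rule suminf_finite[symmetric])
    fix j assume "j \<notin> {..n}"
    hence "n < j * 1"
      by simp
    also have "j * 1 \<le> j * k"
      using k(2) by (intro mult_le_mono2) simp
    finally have "n < j * k" .
    thus "(if j * k \<le> n then (-1) ^ j / (real k ^ j * fact j) * cycle_sum A (n - j * k) F else 0) = 0"
      by simp
  qed simp
  finally show ?thesis .
qed

section \<open>Asymptotics of the cycle counts\<close>

lemma tendsto_diff_nat:
  fixes X :: "nat \<Rightarrow> 'a::topological_space"
  assumes "X \<longlonglongrightarrow> L" shows "(\<lambda>n. X (n - s)) \<longlonglongrightarrow> L"
  by (rule LIMSEQ_offset[where k = s]) (use assms in simp)

section \<open>Consequences of the ratio condition\<close>

context
  fixes u :: "nat \<Rightarrow> real"
  assumes nonneg: "\<And>n. 0 \<le> u n" and ratio: "(\<lambda>n. u n / u (n - 1)) \<longlonglongrightarrow> 1"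
begin

text \<open>Division by zero yields 0, so a ratio close to 1 excludes
  \<open>u n = 0\<close>.\<close>

lemma ratio_eventually_pos: "\<forall>\<^sub>F n in sequentially. 0 < u n"
proof -
  have "\<forall>\<^sub>F n in sequentially. 0 < u n / u (n - 1)"
    by (rule order_tendstoD(1)[OF ratio]) simp
  thus ?thesis
  proof eventually_elim
    case (elim n)
    thus ?case
      using nonneg[of n] by (cases "u n = 0") auto
  qed
qed

lemma ratio_tendsto_shift: "(\<lambda>n. u (n - s) / u n) \<longlonglongrightarrow> 1"
proof (induction s)
  case 0
  have "\<forall>\<^sub>F n in sequentially. u (n - 0) / u n = 1"
    using ratio_eventually_pos by eventually_elim simp
  thus ?case
    by (rule tendsto_eventually)
next
  case (Suc s)
  \<comment> \<open>One more shift multiplies by the inverse of the ratio at index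
    \<open>n - s\<close>, which tends to 1.\<close>
  have "(\<lambda>n. inverse (u (n - s) / u (n - s - 1)) * (u (n - s) / u n)) \<longlonglongrightarrow> inverse 1 * 1"
    by (intro tendsto_mult tendsto_inverse Suc tendsto_diff_nat[of "\<lambda>n. u n / u (n - 1)", OF ratio]) simp
  moreover have "\<forall>\<^sub>F n in sequentially. 0 < u (n - s)"
    using ratio_eventually_pos by (rule eventually_compose_filterlim) (rule filterlim_minus_const_nat_at_top)
  hence "\<forall>\<^sub>F n in sequentially. inverse (u (n - s) / u (n - s - 1)) * (u (n - s) / u n) = u (n - Suc s) / u n"
    by eventually_elim simp
  ultimately show ?case
    by (auto elim: Lim_transform_eventually)
qed

text \<open>From some \<open>N\<close> on the ratio exceeds 1/2, so each step down at most doubles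
  \<open>u\<close>. If the shift passes below \<open>N\<close>, the doubling is used only down to
  \<open>N\<close>, and \<open>u \<le> 1\<close> covers the rest.\<close>

lemma ratio_shift_bound:
  assumes bdd: "\<And>n. u n \<le> 1"
  obtains C where "\<forall>\<^sub>F n in sequentially. \<forall>s\<le>n. u (n - s) / u n \<le> C * 2 ^ s"
proof -
  have "\<forall>\<^sub>F n in sequentially. 1 / 2 < u n / u (n - 1)"
    by (rule order_tendstoD(1)[OF ratio]) simp
  with ratio_eventually_pos have "\<forall>\<^sub>F n in sequentially. 0 < u n \<and> u (n - 1) \<le> 2 * u n"
  proof eventually_elim
    case (elim n)
    hence "u (n - 1) \<noteq> 0"
      by auto
    hence "0 < u (n - 1)"
      using nonneg[of "n - 1"] by simp
    thus ?case
      using elim by (simp add: field_simps)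
  qed
  then obtain N where N: "\<And>n. n \<ge> N \<Longrightarrow> 0 < u n \<and> u (n - 1) \<le> 2 * u n"
    by (auto simp: eventually_sequentially)
  have step: "u (n - s) \<le> 2 ^ s * u n" if "N + s \<le> n" for n s
    using that
  proof (induction s)
    case (Suc s)
    have "u (n - Suc s) \<le> 2 * u (n - s)"
      using N[of "n - s"] Suc.prems by simp
    also have "\<dots> \<le> 2 * (2 ^ s * u n)"
      using Suc by simp
    finally show ?case
      by simp
  qed simp
  \<comment> \<open>The value 1 serves shifts that stay above \<open>N\<close>, and
    \<open>1 / u N\<close> those that end below it.\<close>
  define C where "C = max 1 (1 / u N)"
  have "u (n - s) / u n \<le> C * 2 ^ s" if "n \<ge> N" "s \<le> n" for n s
  proof (cases "N + s \<le> n")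
    case True
    have "u (n - s) \<le> 1 * 2 ^ s * u n"
      using step[OF True] by simp
    also have "\<dots> \<le> C * 2 ^ s * u n"
      using nonneg[of n] by (intro mult_right_mono) (auto simp: C_def)
    finally show ?thesis
      using N[OF that(1)] by (simp add: divide_le_eq)
  next
    case False
    have "u N = u (n - (n - N))"
      using that by simp
    also have "\<dots> \<le> 2 ^ (n - N) * u n"
      using that by (intro step) simp
    also have "\<dots> \<le> 2 ^ s * u n"
      using False nonneg[of n] by (intro mult_right_mono power_increasing) auto
    finally have "1 \<le> 1 / u N * (2 ^ s * u n)"
      using N[of N] by simp
    also have "\<dots> \<le> C * (2 ^ s * u n)"
      using nonneg[of n] by (intro mult_right_mono) (auto simp: C_def)
    finally have "u (n - s) \<le> C * 2 ^ s * u n"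
      using bdd[of "n - s"] by simp
    thus ?thesis
      using N[OF that(1)] by (simp add: divide_le_eq)
  qed
  thus ?thesis
    using that[of C] by (auto simp: eventually_sequentially)
qed

text \<open>Tannery's theorem: the \<open>j\<close>-th term tends to
  \<open>L * (- 1 / k) ^ j / fact j\<close>, whose sum is the exponential. Here \<open>k\<close> is
  the cycle length, while \<open>h\<close> is the index shift caused by removing one such
  cycle.\<close>

lemma ratio_alternating_exp_tendsto:
  fixes t :: "nat \<Rightarrow> real"
  assumes bdd: "\<And>n. u n \<le> 1" and t: "\<And>n. \<bar>t n\<bar> \<le> u n" "(\<lambda>n. t n / u n) \<longlonglongrightarrow> L"
    and k: "1 \<le> k" and h: "0 < h"
  shows "(\<lambda>n. (\<Sum>j. if j * h \<le> n then (-1) ^ j / (k ^ j * fact j) * t (n - j * h) else 0) / u n)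
    \<longlonglongrightarrow> L * exp (- 1 / k)"
proof -
  obtain C where C: "\<forall>\<^sub>F n in sequentially. \<forall>s\<le>n. u (n - s) / u n \<le> C * 2 ^ s"
    using ratio_shift_bound[OF bdd] .
  define a where "a = (\<lambda>j n. if j * h \<le> n then (-1) ^ j / (k ^ j * fact j) * (t (n - j * h) / u n) else 0)"
  define b where "b = (\<lambda>j. (-1) ^ j / (k ^ j * fact j) * L)"
  have term_lim: "(\<lambda>n. t (n - s) / u n) \<longlonglongrightarrow> L" for s
  proof -
    have "(\<lambda>n. t (n - s) / u (n - s) * (u (n - s) / u n)) \<longlonglongrightarrow> L * 1"
      by (intro tendsto_mult ratio_tendsto_shift tendsto_diff_nat[of "\<lambda>n. t n / u n", OF t(2)])
    moreover have "\<forall>\<^sub>F n in sequentially. 0 < u (n - s)"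
      using ratio_eventually_pos by (rule eventually_compose_filterlim) (rule filterlim_minus_const_nat_at_top)
    hence "\<forall>\<^sub>F n in sequentially. t (n - s) / u (n - s) * (u (n - s) / u n) = t (n - s) / u n"
      by eventually_elim simp
    ultimately show ?thesis
      by (auto elim: Lim_transform_eventually)
  qed
  have lim: "(\<lambda>n. a j n) \<longlonglongrightarrow> b j" for j
  proof -
    have "(\<lambda>n. (-1) ^ j / (k ^ j * fact j) * (t (n - j * h) / u n)) \<longlonglongrightarrow> b j"
      unfolding b_def by (intro tendsto_mult tendsto_const term_lim)
    moreover have "\<forall>\<^sub>F n in sequentially. (-1) ^ j / (k ^ j * fact j) * (t (n - j * h) / u n) = a j n"
      using eventually_ge_at_top[of "j * h"] by eventually_elim (simp add: a_def)
    ultimately show ?thesis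
      by (rule Lim_transform_eventually)
  qed
  have "\<forall>\<^sub>F n in sequentially. \<forall>j. norm (a j n) \<le> C * ((2 ^ h) ^ j / fact j)"
    using C ratio_eventually_pos
  proof eventually_elim
    case (elim n)
    \<comment> \<open>The shift 0 gives \<open>1 \<le> C\<close>; the sign settles the indices with
      \<open>j * h > n\<close>, where the term is 0.\<close>
    have "0 \<le> C"
      using elim(1)[rule_format, of 0] elim(2) by simp
    show ?case
    proof
      fix j
      show "norm (a j n) \<le> C * ((2 ^ h) ^ j / fact j)"
      proof (cases "j * h \<le> n")
        case True
        have "norm (a j n) = 1 / (k ^ j * fact j) * (\<bar>t (n - j * h)\<bar> / u n)"
          using True k elim(2) by (simp add: a_def abs_mult power_abs)
        also have "\<dots> \<le> 1 / (1 * fact j) * (u (n - j * h) / u n)"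
          using k t(1) elim(2) nonneg
          by (intro mult_mono divide_left_mono divide_right_mono mult_right_mono one_le_power) auto
        also have "\<dots> \<le> 1 / (1 * fact j) * (C * 2 ^ (j * h))"
          using elim(1) True by (intro mult_left_mono) auto
        also have "\<dots> = C * ((2 ^ h) ^ j / fact j)"
          by (simp add: power_mult[symmetric] mult.commute)
        finally show ?thesis .
      qed (use \<open>0 \<le> C\<close> in \<open>simp add: a_def\<close>)
    qed
  qed
  hence bound: "\<forall>\<^sub>F (j, n) in at_top \<times>\<^sub>F sequentially. norm (a j n) \<le> C * ((2 ^ h) ^ j / fact j)"
    by (subst (asm) eventually_prod2[where A = at_top, symmetric]) (auto elim!: eventually_mono)
  have summable: "summable (\<lambda>j. C * ((2 ^ h) ^ j / fact j))"
    using summable_exp[of "2 ^ h :: real"] by (intro summable_mult) (simp add: field_simps)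
  have "(\<lambda>n. \<Sum>j. a j n) \<longlonglongrightarrow> suminf b"
    using tannerys_theorem[OF lim bound summable] by simp
  also have "suminf b = L * exp (- 1 / k)"
  proof -
    have "(\<lambda>j. L * ((- 1 / k) ^ j /\<^sub>R fact j)) sums (L * exp (- 1 / k))"
      by (intro sums_mult exp_converges)
    also have "(\<lambda>j. L * ((- 1 / k) ^ j /\<^sub>R fact j)) = b"
      unfolding b_def power_divide by (simp add: fun_eq_iff divide_simps)
    finally show ?thesis
      by (simp add: sums_iff)
  qed
  also have "(\<lambda>n. \<Sum>j. a j n) = (\<lambda>n. (\<Sum>j. if j * h \<le> n then (-1) ^ j / (k ^ j * fact j) * t (n - j * h) else 0) / u n)"
  proof
    fix n
    let ?f = "\<lambda>j. if j * h \<le> n then (-1) ^ j / (k ^ j * fact j) * t (n - j * h) else 0"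
    have "summable ?f"
    proof (rule summable_finite[of "{..n}"])
      fix j assume "j \<notin> {..n}"
      hence "n < j * 1"
        by simp
      also have "j * 1 \<le> j * h"
        using h by (intro mult_le_mono2) simp
      finally show "?f j = 0"
        by simp
    qed simp
    moreover have "(\<lambda>j. a j n) = (\<lambda>j. ?f j / u n)"
      by (auto simp: a_def)
    ultimately show "(\<Sum>j. a j n) = (\<Sum>j. ?f j) / u n"
      by (simp only: suminf_divide)
  qed
  finally show ?thesis .
qed

end

text \<open>Adding a length \<open>k\<close> to \<open>K\<close> takes two steps: requiring no
  \<open>k\<close>-cycles produces the factor \<open>exp (- 1 / k)\<close>, and passing from 0 to
  \<open>a k\<close> cycles produces \<open>1 / (k ^ a k * fact (a k))\<close>. Their product is the
  Poisson weight.\<close>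

lemma cycle_counts_tendsto_poisson:
  fixes A :: "nat set" and q :: nat and a :: "nat \<Rightarrow> nat"
  defines "u \<equiv> \<lambda>n. cycle_sum A (q * n) (\<lambda>_. 1)"
  assumes pos: "\<forall>a\<in>A. 0 < a" and q: "q = Gcd A"
    and ratio: "(\<lambda>n. u n / u (n - 1)) \<longlonglongrightarrow> 1"
    and "finite K" "K \<subseteq> A"
  shows "(\<lambda>n. cycle_sum A (q * n) (\<lambda>c. of_bool (\<forall>k\<in>K. c k = a k)) / u n)
    \<longlonglongrightarrow> (\<Prod>k\<in>K. pmf (poisson_pmf (1 / real k)) (a k))"
  using \<open>finite K\<close> \<open>K \<subseteq> A\<close>
proof (induction rule: finite_induct)
  case empty
  have nonneg: "0 \<le> u n" for n
    by (simp add: u_def cycle_sum_def)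
  have "\<forall>\<^sub>F n in sequentially. u n / u n = 1"
    using ratio_eventually_pos[OF nonneg ratio] by eventually_elim simp
  hence "(\<lambda>n. u n / u n) \<longlonglongrightarrow> 1"
    by (rule tendsto_eventually)
  thus ?case
    by (simp add: u_def)
next
  case (insert k K)
  define F where "F = (\<lambda>c :: nat \<Rightarrow> nat. of_bool (\<forall>k\<in>K. c k = a k) :: real)"
  define t where "t = (\<lambda>n. cycle_sum A (q * n) F)"
  define z where "z = (\<lambda>n. cycle_sum A (q * n) (\<lambda>c. of_bool (c k = 0) * F c))"
  define L where "L = (\<Prod>k\<in>K. pmf (poisson_pmf (1 / real k)) (a k))"
  have k: "k \<in> A" "0 < k" "k \<notin> K"
    using insert pos by auto
  \<comment> \<open>As \<open>q\<close> divides every length in \<open>A\<close>, removing a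
    \<open>k\<close>-cycle from \<open>q * n\<close> points lowers the index \<open>n\<close> by
    exactly \<open>h\<close>.\<close>
  obtain h where h: "k = q * h"
    using Gcd_dvd[OF k(1)] q by (auto simp: dvd_def)
  have q_pos: "0 < q" and h_pos: "0 < h"
    using k(2) h by auto
  have F: "F (c(k := v)) = F c" for c v
    using k(3) by (auto simp: F_def intro!: arg_cong[where f = of_bool])
  have nonneg: "0 \<le> u n" for n
    by (simp add: u_def cycle_sum_def)
  have u_le: "u n \<le> 1" for n
    by (simp add: u_def cycle_sum_one_le)
  have t: "\<bar>t n\<bar> \<le> u n" for n
    unfolding t_def u_def by (rule abs_cycle_sum_le) (simp add: F_def)
  have t_lim: "(\<lambda>n. t n / u n) \<longlonglongrightarrow> L"
    using insert unfolding t_def L_def F_def by simp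
  \<comment> \<open>Multiplication by \<open>q\<close> distributes over truncated subtraction, so
    the second identity holds even when \<open>j * h > n\<close>.\<close>
  have le_iff: "j * k \<le> q * n \<longleftrightarrow> j * h \<le> n" and diff_eq: "q * n - j * k = q * (n - j * h)" for j n
    using q_pos by (simp_all add: h diff_mult_distrib2 mult.left_commute[of j])
  have "z n = (\<Sum>j. if j * h \<le> n then (-1) ^ j / (real k ^ j * fact j) * t (n - j * h) else 0)" for n
    unfolding z_def cycle_sum_count_zero[where F = F, OF k(1,2) F] le_iff diff_eq t_def ..
  hence z_lim: "(\<lambda>n. z n / u n) \<longlonglongrightarrow> L * exp (- 1 / k)"
    using ratio_alternating_exp_tendsto[OF nonneg ratio u_le t t_lim, of "real k" h] k(2) h_pos by simp
  have count: "cycle_sum A (q * n) (\<lambda>c. of_bool (\<forall>i\<in>insert k K. c i = a i)) =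
      (if a k * h \<le> n then z (n - a k * h) / (real k ^ a k * fact (a k)) else 0)" for n
  proof -
    have "(\<lambda>c. of_bool (\<forall>i\<in>insert k K. c i = a i)) = (\<lambda>c. of_bool (c k = a k) * F c)"
      by (auto simp: F_def fun_eq_iff)
    thus ?thesis
      by (simp only: cycle_sum_count_eq[where F = F and a = "a k" and n = "q * n", OF k(1,2) F]
        le_iff diff_eq z_def)
  qed
  let ?s = "a k * h" and ?w = "real k ^ a k * fact (a k)"
  \<comment> \<open>Removing the \<open>a k\<close> cycles shifts the index by \<open>?s\<close>;
    the ratio of \<open>u\<close> at the two indices tends to 1.\<close>
  have "(\<lambda>n. z (n - ?s) / u (n - ?s) * (u (n - ?s) / u n) / ?w) \<longlonglongrightarrow> L * exp (- 1 / k) * 1 / ?w"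
    using k(2) by (intro tendsto_divide tendsto_mult tendsto_const ratio_tendsto_shift[OF nonneg ratio]
      tendsto_diff_nat[of "\<lambda>n. z n / u n", OF z_lim]) auto
  moreover have "\<forall>\<^sub>F n in sequentially. 0 < u (n - ?s)"
    using ratio_eventually_pos[OF nonneg ratio]
    by (rule eventually_compose_filterlim) (rule filterlim_minus_const_nat_at_top)
  hence "\<forall>\<^sub>F n in sequentially. z (n - ?s) / u (n - ?s) * (u (n - ?s) / u n) / ?w =
      cycle_sum A (q * n) (\<lambda>c. of_bool (\<forall>i\<in>insert k K. c i = a i)) / u n"
    using eventually_ge_at_top[of ?s] unfolding count by eventually_elim simp
  ultimately have "(\<lambda>n. cycle_sum A (q * n) (\<lambda>c. of_bool (\<forall>i\<in>insert k K. c i = a i)) / u n)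
      \<longlonglongrightarrow> L * exp (- 1 / k) * 1 / ?w"
    by (rule Lim_transform_eventually)
  also have "L * exp (- 1 / k) * 1 / ?w = (\<Prod>k\<in>insert k K. pmf (poisson_pmf (1 / real k)) (a k))"
    using insert(1,2) k(2) by (simp add: L_def pmf_poisson power_divide field_simps)
  finally show ?case .
qed

section \<open>Weak convergence\<close>

text \<open>Puts all the measures over the common base \<open>count_space X\<close>, so that point
  masses become densities to which Scheffe's lemma applies.\<close>

lemma prob_space_eq_density_singletons:
  assumes "prob_space N" "sets N = Pow X" "countable X"
  shows "N = density (count_space X) (\<lambda>x. ennreal (measure N {x}))"
proof (rule measure_eqI_countable[where A = X])
  interpret prob_space N by fact
  fix x assume "x \<in> X"
  thus "emeasure N {x} = emeasure (density (count_space X) (\<lambda>x. ennreal (measure N {x}))) {x}"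
    by (subst emeasure_density) (auto simp: emeasure_eq_measure nn_integral_indicator_singleton)
qed (use assms in auto)

text \<open>By Scheffe's lemma, pointwise convergence of probability densities gives convergence in
  L1. A bound \<open>B\<close> on \<open>f\<close> then controls the difference of the integrals by
  \<open>B\<close> times the L1 distance.\<close>

lemma integral_tendsto_countable_space:
  fixes \<mu> :: "nat \<Rightarrow> 'a measure" and f :: "'a \<Rightarrow> real"
  assumes \<mu>: "\<And>n. prob_space (\<mu> n)" "\<And>n. sets (\<mu> n) = Pow X"
    and \<nu>: "prob_space \<nu>" "sets \<nu> = Pow X" and X: "countable X"
    and lim: "\<And>x. x \<in> X \<Longrightarrow> (\<lambda>n. measure (\<mu> n) {x}) \<longlonglongrightarrow> measure \<nu> {x}"
    and f: "bounded (f ` X)"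
  shows "(\<lambda>n. integral\<^sup>L (\<mu> n) f) \<longlonglongrightarrow> integral\<^sup>L \<nu> f"
proof -
  obtain B where B: "\<And>x. x \<in> X \<Longrightarrow> \<bar>f x\<bar> \<le> B"
    using f by (auto simp: bounded_iff)
  have total: "(\<integral>\<^sup>+x. ennreal (measure N {x}) \<partial>count_space X) = 1"
    if "prob_space N" "sets N = Pow X" for N
  proof -
    have "(\<integral>\<^sup>+x. ennreal (measure N {x}) \<partial>count_space X) =
        emeasure (density (count_space X) (\<lambda>x. ennreal (measure N {x}))) X"
      by (subst emeasure_density) (auto intro!: nn_integral_cong)
    also have "\<dots> = emeasure N X"
      using prob_space_eq_density_singletons[OF that X] by simp
    also have "\<dots> = 1"
      using prob_space.emeasure_space_1[OF that(1)] sets_eq_imp_space_eq[of N "count_space X"] that(2) by simp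
    finally show ?thesis .
  qed
  have int: "integrable (count_space X) (\<lambda>x. measure N {x})"
    if "prob_space N" "sets N = Pow X" for N
    using total[OF that] by (intro integrableI_bounded) auto
  have int_f: "integrable (count_space X) (\<lambda>x. measure N {x} * f x)"
    if "prob_space N" "sets N = Pow X" for N
    by (rule Bochner_Integration.integrable_bound[OF integrable_mult_right[OF int[OF that], of B]])
      (use B in \<open>auto simp: AE_count_space abs_mult mult.commute[of B] intro!: mult_left_mono order_trans[OF _ abs_ge_self]\<close>)
  have eq: "integral\<^sup>L N f = (\<integral>x. measure N {x} * f x \<partial>count_space X)"
    if "prob_space N" "sets N = Pow X" for N
    by (subst prob_space_eq_density_singletons[OF that X], subst integral_density) auto
  have "(\<lambda>n. \<integral>\<^sup>+x. norm (measure (\<mu> n) {x} - measure \<nu> {x}) \<partial>count_space X) \<longlonglongrightarrow> 0"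
    by (rule Scheffe_lemma2) (use int[OF \<nu>] total[OF \<mu>] total[OF \<nu>] lim in \<open>auto simp: AE_count_space\<close>)
  \<comment> \<open>The limit is written as \<open>ennreal 0\<close> so that
    \<open>tendsto_enn2real\<close> applies.\<close>
  hence "(\<lambda>n. \<integral>\<^sup>+x. norm (measure (\<mu> n) {x} - measure \<nu> {x}) \<partial>count_space X) \<longlonglongrightarrow> ennreal 0"
    by simp
  from tendsto_enn2real[OF this]
  have L1: "(\<lambda>n. \<integral>x. \<bar>measure (\<mu> n) {x} - measure \<nu> {x}\<bar> \<partial>count_space X) \<longlonglongrightarrow> 0"
    by (simp add: integral_eq_nn_integral)
  show ?thesis
  proof (rule LIM_zero_cancel, rule tendsto_rabs_zero_cancel, rule tendsto_sandwich[OF _ _ tendsto_const])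
    show "(\<lambda>n. B * (\<integral>x. \<bar>measure (\<mu> n) {x} - measure \<nu> {x}\<bar> \<partial>count_space X)) \<longlonglongrightarrow> 0"
      using tendsto_mult_left[OF L1, of B] by simp
    have "\<bar>integral\<^sup>L (\<mu> n) f - integral\<^sup>L \<nu> f\<bar> \<le> B * (\<integral>x. \<bar>measure (\<mu> n) {x} - measure \<nu> {x}\<bar> \<partial>count_space X)" for n
    proof -
      have "integral\<^sup>L (\<mu> n) f - integral\<^sup>L \<nu> f =
          (\<integral>x. measure (\<mu> n) {x} * f x - measure \<nu> {x} * f x \<partial>count_space X)"
        unfolding eq[OF \<mu>] eq[OF \<nu>] using int_f[OF \<mu>] int_f[OF \<nu>] by simp
      also have "\<bar>\<dots>\<bar> \<le> (\<integral>x. B * \<bar>measure (\<mu> n) {x} - measure \<nu> {x}\<bar> \<partial>count_space X)"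
      proof (rule integral_abs_bound[THEN order_trans], rule integral_mono)
        show "integrable (count_space X) (\<lambda>x. \<bar>measure (\<mu> n) {x} * f x - measure \<nu> {x} * f x\<bar>)"
          using int_f[OF \<mu>] int_f[OF \<nu>] by simp
        show "integrable (count_space X) (\<lambda>x. B * \<bar>measure (\<mu> n) {x} - measure \<nu> {x}\<bar>)"
          using int[OF \<mu>] int[OF \<nu>] by simp
        fix x assume "x \<in> space (count_space X)"
        hence "\<bar>f x\<bar> * \<bar>measure (\<mu> n) {x} - measure \<nu> {x}\<bar> \<le> B * \<bar>measure (\<mu> n) {x} - measure \<nu> {x}\<bar>"
          using B by (intro mult_right_mono) auto
        thus "\<bar>measure (\<mu> n) {x} * f x - measure \<nu> {x} * f x\<bar> \<le> B * \<bar>measure (\<mu> n) {x} - measure \<nu> {x}\<bar>"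
          by (simp add: abs_mult[symmetric] algebra_simps)
      qed
      finally show ?thesis
        by simp
    qed
    thus "\<forall>\<^sub>F n in sequentially. \<bar>integral\<^sup>L (\<mu> n) f - integral\<^sup>L \<nu> f\<bar> \<le>
        B * (\<integral>x. \<bar>measure (\<mu> n) {x} - measure \<nu> {x}\<bar> \<partial>count_space X)"
      by simp
  qed simp
qed

section \<open>Laws of the cycle counts and of their Poisson limit\<close>

lemma perms_with_cycle_lengths_eq: "perms_with_cycle_lengths A n = restricted_perms A {1..n}"
  by (auto simp: perms_with_cycle_lengths_def restricted_perms_def perm_cycles_def)

lemma cycle_count_eq_cycle_type: "cycle_count n k p = cycle_type p {1..n} k"
  by (simp add: cycle_count_def cycle_type_def perm_cycles_def)

lemma measure_distr_cycle_counts: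
  fixes M :: "'w measure" and \<sigma> :: "'w \<Rightarrow> nat \<Rightarrow> nat" and K A :: "nat set" and n :: nat
  defines "P \<equiv> \<Pi>\<^sub>M k\<in>K. count_space (UNIV :: nat set)"
    and "S \<equiv> perms_with_cycle_lengths A n"
    and "counts \<equiv> \<lambda>p. \<lambda>k\<in>K. cycle_count n k p"
  assumes M: "prob_space M" and \<sigma>: "\<sigma> \<in> measurable M (count_space S)"
    and unif: "distr M (count_space S) \<sigma> = uniform_count_measure S"
    and K: "finite K" and a: "a \<in> PiE K (\<lambda>_. UNIV)"
  shows "prob_space (distr M P (\<lambda>\<omega>. counts (\<sigma> \<omega>)))"
    and "measure (distr M P (\<lambda>\<omega>. counts (\<sigma> \<omega>))) {a} =
      cycle_sum A n (\<lambda>c. of_bool (\<forall>k\<in>K. c k = a k)) / cycle_sum A n (\<lambda>_. 1)"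
proof -
  \<comment> \<open>A finite product of discrete countable spaces is discrete, so every map into it
    from a discrete space is measurable.\<close>
  have P: "P = count_space (PiE K (\<lambda>_. UNIV))"
    unfolding P_def using K by (intro count_space_PiM_finite) auto
  have counts: "counts \<in> measurable (count_space S) P"
    by (auto simp: P counts_def)
  have meas: "(\<lambda>\<omega>. counts (\<sigma> \<omega>)) \<in> measurable M P"
    using measurable_compose[OF \<sigma> counts] .
  show "prob_space (distr M P (\<lambda>\<omega>. counts (\<sigma> \<omega>)))"
    by (rule prob_space.prob_space_distr[OF M meas])
  have S: "finite S" "S = restricted_perms A {1..n}"
    by (auto simp: S_def perms_with_cycle_lengths_eq)
  have "distr M P (\<lambda>\<omega>. counts (\<sigma> \<omega>)) = distr (uniform_count_measure S) P counts"
    unfolding unif[symmetric] by (subst distr_distr[OF counts \<sigma>]) (simp add: o_def)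
  also have "measure \<dots> {a} = measure (uniform_count_measure S) {p \<in> S. counts p = a}"
    using a counts
    by (subst measure_distr) (auto simp: P measurable_def space_uniform_count_measure sets_uniform_count_measure
      intro!: arg_cong2[where f = measure])
  also have "\<dots> = card {p \<in> S. counts p = a} / card S"
    using S(1) by (subst measure_uniform_count_measure) auto
  \<comment> \<open>Both \<open>counts p\<close> and \<open>a\<close> are \<open>undefined\<close>
    outside \<open>K\<close>, so they are equal as soon as they agree on \<open>K\<close>.\<close>
  also have "{p \<in> S. counts p = a} = {p \<in> S. \<forall>k\<in>K. cycle_type p {1..n} k = a k}"
    using a unfolding counts_def cycle_count_eq_cycle_type by (auto simp: PiE_iff extensional_def fun_eq_iff)
  also have "real (card \<dots>) / real (card S) =
      cycle_sum A n (\<lambda>c. of_bool (\<forall>k\<in>K. c k = a k)) / cycle_sum A n (\<lambda>_. 1)"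
    using S by (simp add: cycle_sum_def sum_of_bool_eq Int_def)
  finally show "measure (distr M P (\<lambda>\<omega>. counts (\<sigma> \<omega>))) {a} =
      cycle_sum A n (\<lambda>c. of_bool (\<forall>k\<in>K. c k = a k)) / cycle_sum A n (\<lambda>_. 1)" .
qed

text \<open>The singleton \<open>{a}\<close> is itself a product of singletons, as \<open>a\<close>
  is extensional.\<close>

lemma measure_PiM_pmf_singleton:
  assumes K: "finite K" and a: "a \<in> PiE K (\<lambda>_. UNIV)"
  shows "measure (\<Pi>\<^sub>M k\<in>K. measure_pmf (p k)) {a} = (\<Prod>k\<in>K. pmf (p k) (a k))"
proof -
  interpret product_prob_space "\<lambda>k. measure_pmf (p k)" K ..
  have "{a} = PiE K (\<lambda>k. {a k})"
    using a by (auto simp: PiE_singleton PiE_iff)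
  hence "emeasure (\<Pi>\<^sub>M k\<in>K. measure_pmf (p k)) {a} = (\<Prod>k\<in>K. emeasure (measure_pmf (p k)) {a k})"
    using K by (simp add: emeasure_PiM)
  thus ?thesis
    by (simp add: measure_def emeasure_pmf_single prod_ennreal prod_nonneg)
qed

theorem proposition2p1:
  fixes A :: "nat set" and q :: nat and u :: "nat \<Rightarrow> real"
    and M :: "nat \<Rightarrow> 'w measure" and \<sigma> :: "nat \<Rightarrow> 'w \<Rightarrow> (nat \<Rightarrow> nat)"
  assumes pos: "\<forall>a\<in>A. 0 < a"
    and q: "q = Gcd A"
    and u: "\<forall>n. u n = real (card (perms_with_cycle_lengths A (q * n))) / fact (q * n)"
    and ratio: "(\<lambda>n. u n / u (n - 1)) \<longlonglongrightarrow> 1"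
    and uniform: "\<forall>\<^sub>F n in sequentially.
          prob_space (M n) \<and>
          \<sigma> n \<in> measurable (M n) (count_space (perms_with_cycle_lengths A (q * n))) \<and>
          distr (M n) (count_space (perms_with_cycle_lengths A (q * n))) (\<sigma> n) =
            uniform_count_measure (perms_with_cycle_lengths A (q * n))"
  shows "\<forall>l\<ge>1.
          weak_conv_in (product_topology (\<lambda>k. euclidean :: nat topology) {k\<in>A. 1 \<le> k \<and> k \<le> l})
            (\<lambda>n. distr (M n) (\<Pi>\<^sub>M k\<in>{k\<in>A. 1 \<le> k \<and> k \<le> l}. count_space (UNIV :: nat set))
                    (\<lambda>\<omega>. \<lambda>k\<in>{k\<in>A. 1 \<le> k \<and> k \<le> l}. cycle_count (q * n) k (\<sigma> n \<omega>)))
            (\<Pi>\<^sub>M k\<in>{k\<in>A. 1 \<le> k \<and> k \<le> l}. measure_pmf (poisson_pmf (1 / real k)))"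
proof (intro allI impI)
  fix l :: nat
  define K where "K = {k \<in> A. 1 \<le> k \<and> k \<le> l}"
  define X :: "(nat \<Rightarrow> nat) set" where "X = PiE K (\<lambda>_. UNIV)"
  define \<mu> where "\<mu> = (\<lambda>n. distr (M n) (\<Pi>\<^sub>M k\<in>K. count_space (UNIV :: nat set))
    (\<lambda>\<omega>. \<lambda>k\<in>K. cycle_count (q * n) k (\<sigma> n \<omega>)))"
  define \<nu> where "\<nu> = (\<Pi>\<^sub>M k\<in>K. measure_pmf (poisson_pmf (1 / real k)))"
  have K: "finite K" "K \<subseteq> A"
    by (auto simp: K_def)
  have X: "countable X"
    unfolding X_def using K(1) by (intro countable_PiE) auto
  have P: "(\<Pi>\<^sub>M k\<in>K. count_space (UNIV :: nat set)) = count_space X"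
    unfolding X_def using K(1) by (intro count_space_PiM_finite) auto
  have "sets \<nu> = sets (\<Pi>\<^sub>M k\<in>K. count_space (UNIV :: nat set))"
    unfolding \<nu>_def by (intro sets_PiM_cong) auto
  hence sets_\<nu>: "sets \<nu> = Pow X"
    by (simp add: P)
  have prob_\<nu>: "prob_space \<nu>"
    unfolding \<nu>_def by (intro prob_space_PiM prob_space_measure_pmf)
  have u_eq: "u n = cycle_sum A (q * n) (\<lambda>_. 1)" for n
    using u by (simp add: cycle_sum_def perms_with_cycle_lengths_eq)
  \<comment> \<open>The uniform law is guaranteed only from some index on. The limits are therefore
    taken along \<open>n + N\<close> and transferred back at the end.\<close>
  obtain N where N: "\<And>n. n \<ge> N \<Longrightarrow> prob_space (M n) \<and>
      \<sigma> n \<in> measurable (M n) (count_space (perms_with_cycle_lengths A (q * n))) \<and>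
      distr (M n) (count_space (perms_with_cycle_lengths A (q * n))) (\<sigma> n) =
        uniform_count_measure (perms_with_cycle_lengths A (q * n))"
    using uniform by (auto simp: eventually_sequentially)
  have lim: "(\<lambda>n. measure (\<mu> (n + N)) {a}) \<longlonglongrightarrow> measure \<nu> {a}" if a: "a \<in> X" for a
  proof -
    have "(\<lambda>n. cycle_sum A (q * n) (\<lambda>c. of_bool (\<forall>k\<in>K. c k = a k)) / cycle_sum A (q * n) (\<lambda>_. 1))
        \<longlonglongrightarrow> (\<Prod>k\<in>K. pmf (poisson_pmf (1 / real k)) (a k))"
      using cycle_counts_tendsto_poisson[OF pos q _ K] ratio unfolding u_eq by blast
    also have "(\<Prod>k\<in>K. pmf (poisson_pmf (1 / real k)) (a k)) = measure \<nu> {a}"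
      using measure_PiM_pmf_singleton[OF K(1), of a] a by (simp add: \<nu>_def X_def)
    finally have "(\<lambda>n. cycle_sum A (q * (n + N)) (\<lambda>c. of_bool (\<forall>k\<in>K. c k = a k)) /
        cycle_sum A (q * (n + N)) (\<lambda>_. 1)) \<longlonglongrightarrow> measure \<nu> {a}"
      by (rule LIMSEQ_ignore_initial_segment)
    also have "(\<lambda>n. cycle_sum A (q * (n + N)) (\<lambda>c. of_bool (\<forall>k\<in>K. c k = a k)) /
        cycle_sum A (q * (n + N)) (\<lambda>_. 1)) = (\<lambda>n. measure (\<mu> (n + N)) {a})"
      unfolding \<mu>_def using N a
      by (subst measure_distr_cycle_counts(2)[where A = A]) (auto simp: K X_def)
    finally show ?thesis .
  qed
  have "weak_conv_in (product_topology (\<lambda>k. euclidean) K) \<mu> \<nu>"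
    unfolding weak_conv_in_def
  proof (intro allI impI)
    fix f :: "(nat \<Rightarrow> nat) \<Rightarrow> real"
    assume "continuous_map (product_topology (\<lambda>k. euclidean) K) euclideanreal f \<and>
      bounded (f ` topspace (product_topology (\<lambda>k. euclidean) K))"
    hence f: "bounded (f ` X)"
      by (simp add: X_def)
    have "(\<lambda>n. integral\<^sup>L (\<mu> (n + N)) f) \<longlonglongrightarrow> integral\<^sup>L \<nu> f"
    proof (rule integral_tendsto_countable_space[OF _ _ prob_\<nu> sets_\<nu> X lim f])
      \<comment> \<open>The restricted zero vector merely supplies a point of the product
        space.\<close>
      show "prob_space (\<mu> (n + N))" for n
        unfolding \<mu>_def using N[of "n + N"] K(1)
        by (intro measure_distr_cycle_counts(1)[where A = A and a = "\<lambda>k\<in>K. 0"]) auto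
      show "sets (\<mu> (n + N)) = Pow X" for n
        by (simp add: \<mu>_def P)
    qed
    thus "(\<lambda>n. integral\<^sup>L (\<mu> n) f) \<longlonglongrightarrow> integral\<^sup>L \<nu> f"
      by (rule LIMSEQ_offset)
  qed
  thus "weak_conv_in (product_topology (\<lambda>k. euclidean :: nat topology) {k\<in>A. 1 \<le> k \<and> k \<le> l})
      (\<lambda>n. distr (M n) (\<Pi>\<^sub>M k\<in>{k\<in>A. 1 \<le> k \<and> k \<le> l}. count_space (UNIV :: nat set))
        (\<lambda>\<omega>. \<lambda>k\<in>{k\<in>A. 1 \<le> k \<and> k \<le> l}. cycle_count (q * n) k (\<sigma> n \<omega>)))
      (\<Pi>\<^sub>M k\<in>{k\<in>A. 1 \<le> k \<and> k \<le> l}. measure_pmf (poisson_pmf (1 / real k)))"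
    unfolding \<mu>_def \<nu>_def K_def .
qed

end
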